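(* For every oval $\gamma$, the set of $3$-periodic points of its outer length billiard map $T$, $\{M: T^3(M)=M\}$, has empty interior in the exterior of $\gamma$. Likewise, the set of $4$-periodic points, $\{M: T^4(M)=M\}$, has empty interior.
   Context: Let $\gamma$ be an oval: a smooth closed curve in $\mathbb R^2$ with everywhere positive curvature, oriented counterclockwise. Its support function is a smooth $2\pi$-periodic $p$ with $p+p''>0$. $L(\alpha)=\{x\cos\alpha+y\sin\alpha=p(\alpha)\}$ is the tangent line with outer normal $(\cos\alpha,\sin\alpha)$, touching $\gamma$ at $\gamma(\alpha)=p(\alpha)(\cos\alpha,\sin\alpha)+p'(\alpha)(-\sin\alpha,\cos\alpha)$. Every point exterior to $\gamma$ is $M=L(\alpha_1)\cap L(\alpha_2)$ with $\alpha_1<\alpha_2<\alpha_1+\pi$. The outer length billiard map is $T(M)=L(\alpha_2)\cap L(\alpha_3)$, where $\alpha_3\in(\alpha_2,\alpha_2+\pi)$ is defined as follows. Let $K$ be the circle tangent to $L(\alpha_2)$ at $\gamma(\alpha_2)$, lying on the side of $L(\alpha_2)$ not containing $\gamma$, and tangent to $L(\alpha_1)$. Then $L(\alpha_3)$ is the common tangent line of $\gamma$ and $K$, other than $L(\alpha_1)$ and $L(\alpha_2)$, that leaves $\gamma$ and $K$ on the same side. *)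

theory Defs
  imports "HOL-Analysis.Analysis"
begin

text \<open>Points of the plane are pairs (x, y) of reals.  An oval is given by its
support function p.\<close>

definition oval_support :: "(real \<Rightarrow> real) \<Rightarrow> bool" where
  "oval_support p \<longleftrightarrow>
     (\<forall>n x. ((deriv ^^ n) p) differentiable (at x)) \<and>
     (\<forall>x. p (x + 2 * pi) = p x) \<and>
     (\<forall>x. p x + deriv (deriv p) x > 0)"

text \<open>Tangent line L(alpha) with outer normal (cos alpha, sin alpha).\<close>
definition tline :: "(real \<Rightarrow> real) \<Rightarrow> real \<Rightarrow> (real \<times> real) set" where
  "tline p a = {(x, y). x * cos a + y * sin a = p a}"

definition gpt :: "(real \<Rightarrow> real) \<Rightarrow> real \<Rightarrow> real \<times> real" where
  "gpt p a = (p a * cos a - deriv p a * sin a, p a * sin a + deriv p a * cos a)"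

text \<open>Exterior of the oval: complement of the convex body
  {z. for all alpha, z . u(alpha) <= p(alpha)}.\<close>
definition oval_exterior :: "(real \<Rightarrow> real) \<Rightarrow> (real \<times> real) set" where
  "oval_exterior p = {(x, y). \<exists>a. x * cos a + y * sin a > p a}"

definition circle2 :: "real \<times> real \<Rightarrow> real \<Rightarrow> (real \<times> real) set" where
  "circle2 c r = {z. dist z c = r}"

text \<open>The circle K (center, radius): tangent to L(a2) at gamma(a2), on the side of
  L(a2) not containing gamma, and tangent to L(a1).\<close>
definition circK :: "(real \<Rightarrow> real) \<Rightarrow> real \<Rightarrow> real \<Rightarrow> (real \<times> real) \<times> real" where
  "circK p a1 a2 = (THE (c, r). r > 0 \<and>
       c = (fst (gpt p a2) + r * cos a2, snd (gpt p a2) + r * sin a2) \<and>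
       \<bar>fst c * cos a1 + snd c * sin a1 - p a1\<bar> = r)"

definition next_angle :: "(real \<Rightarrow> real) \<Rightarrow> real \<Rightarrow> real \<Rightarrow> real" where
  "next_angle p a1 a2 = (let (c, r) = circK p a1 a2 in
     THE a3. a2 < a3 \<and> a3 < a2 + pi \<and>
       tline p a3 \<noteq> tline p a1 \<and> tline p a3 \<noteq> tline p a2 \<and>
       \<bar>fst c * cos a3 + snd c * sin a3 - p a3\<bar> = r \<and>
       (\<forall>z\<in>circle2 c r. fst z * cos a3 + snd z * sin a3 \<le> p a3))"

definition outer_T :: "(real \<Rightarrow> real) \<Rightarrow> real \<times> real \<Rightarrow> real \<times> real" where
  "outer_T p M = (let (a1, a2) = (SOME (a1, a2). a1 < a2 \<and> a2 < a1 + pi \<and>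
                                     M \<in> tline p a1 \<and> M \<in> tline p a2)
                  in THE N. N \<in> tline p a2 \<inter> tline p (next_angle p a1 a2))"

end

theory Submission
  imports Defs
begin

text \<open>
  The circle \<open>K\<close> has radius \<open>R(\<alpha>\<^sub>2, \<alpha>\<^sub>1)\<close>, where
  \<open>R(a, b) = (p(b) - \<gamma>(a) \<bullet> u(b)) / (1 + cos (b - a))\<close> is the radius of the circle touching \<open>L(a)\<close> at
  \<open>\<gamma>(a)\<close> from outside and touching \<open>L(b)\<close> from inside. Hence \<open>\<alpha>\<^sub>3\<close> is determined by the balance
  \<open>R(\<alpha>\<^sub>2, \<alpha>\<^sub>1) = R(\<alpha>\<^sub>2, \<alpha>\<^sub>3)\<close>. Positive curvature makes \<open>R(a, b)\<close> strictly increasing as \<open>a\<close> and \<open>b\<close>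
  move apart, in either variable. Since three or four steps of \<open>T\<close> advance the angle by less than
  \<open>4\<pi>\<close>, a 3- or 4-periodic point closes up after exactly one turn. Comparing the balances of two such
  orbits with the same \<open>\<alpha>\<^sub>2\<close>, monotonicity shows that they coincide. But an open set of
  exterior points contains two points on a common tangent line \<open>L(\<alpha>\<^sub>2)\<close>.
\<close>

section \<open>Support functions, the gap and the tangent-circle radius\<close>

text \<open>The derivatives are parameters so that all results can be instantiated at the reflected
  and at the translated oval, whose derivatives are then given explicitly.\<close>

locale support_function =
  fixes p p1 p2 :: "real \<Rightarrow> real"
  assumes D1: "(p has_real_derivative p1 x) (at x)"
    and D2: "(p1 has_real_derivative p2 x) (at x)"
    and periodic: "p (x + 2 * pi) = p x"
    and curvature_pos: "p x + p2 x > 0"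
begin

text \<open>The signed distance from the contact point \<gamma>(a) to the line \<open>L(b)\<close>,
  that is \<open>p b\<close> minus the inner product of \<gamma>(a) with the normal at
  \<open>b\<close>.\<close>

definition gap :: "real \<Rightarrow> real \<Rightarrow> real" where
  "gap a b = p b - p a * cos (b - a) - p1 a * sin (b - a)"

text \<open>A circle of radius r touching \<open>L(a)\<close> from outside at \<gamma>(a) has its
  centre at distance \<open>gap a b - r * cos (b - a)\<close> below \<open>L(b)\<close>. Equating
  this distance with r gives the formula.\<close>

definition exradius :: "real \<Rightarrow> real \<Rightarrow> real" where
  "exradius a b = gap a b / (1 + cos (b - a))"

text \<open>Reflection in the first coordinate axis reverses the order of angles, so every
  monotonicity statement for \<open>a < b\<close> yields its mirror image for
  \<open>b < a\<close>.\<close>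

lemma reflect: "support_function (\<lambda>x. p (- x)) (\<lambda>x. - p1 (- x)) (\<lambda>x. p2 (- x))"
proof
  fix x
  show "((\<lambda>x. p (- x)) has_real_derivative - p1 (- x)) (at x)"
    using D1[of "- x"] by (simp add: DERIV_mirror)
  show "((\<lambda>x. - p1 (- x)) has_real_derivative p2 (- x)) (at x)"
    using D2[of "- x"] DERIV_minus[of "\<lambda>x. p1 (- x)" "- p2 (- x)" x UNIV]
    by (simp add: DERIV_mirror)
  show "p (- (x + 2 * pi)) = p (- x)"
    using periodic[of "- x - 2 * pi"] by (simp add: algebra_simps)
  show "p (- x) + p2 (- x) > 0" by (rule curvature_pos)
qed

lemma gap_reflect:
  "support_function.gap (\<lambda>x. p (- x)) (\<lambda>x. - p1 (- x)) (- a) (- b) = gap a b"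
proof -
  have "cos (a - b) = cos (b - a)" "sin (a - b) = - sin (b - a)"
    by (simp_all add: cos_diff sin_diff)
  then show ?thesis by (simp add: gap_def support_function.gap_def[OF reflect])
qed

lemma exradius_reflect:
  "support_function.exradius (\<lambda>x. p (- x)) (\<lambda>x. - p1 (- x)) (- a) (- b) = exradius a b"
proof -
  have "cos (a - b) = cos (b - a)" by (simp add: cos_diff)
  then show ?thesis
    by (simp add: exradius_def support_function.exradius_def[OF reflect] gap_reflect)
qed

lemma periodic_int: "p (x + 2 * pi * of_int k) = p x"
proof -
  have nat: "p (x + 2 * pi * real n) = p x" for n :: nat and x
  proof (induction n)
    case (Suc n)
    then show ?case using periodic[of "x + 2 * pi * real n"] by (simp add: algebra_simps)
  qed simp
  show ?thesis
  proof (cases k)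
    case (nonneg n)
    then show ?thesis using nat by simp
  next
    case (neg n)
    have "x + 2 * pi * of_int k + 2 * pi * real (Suc n) = x" by (simp add: neg algebra_simps)
    then show ?thesis using nat[of "x + 2 * pi * of_int k" "Suc n"] by (simp only:)
  qed
qed

lemma periodic_int_deriv: "p1 (x + 2 * pi * of_int k) = p1 x"
proof -
  have "((\<lambda>t. p (t + 2 * pi * of_int k)) has_real_derivative p1 (x + 2 * pi * of_int k)) (at x)"
    using D1 by (simp flip: DERIV_shift)
  then have "(p has_real_derivative p1 (x + 2 * pi * of_int k)) (at x)"
    by (simp only: periodic_int)
  then show ?thesis using D1 DERIV_unique by blast
qed

lemma exradius_shift:
  "exradius (a + 2 * pi * of_int k) (b + 2 * pi * of_int k) = exradius a b"
  by (simp add: exradius_def gap_def periodic_int periodic_int_deriv)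

section \<open>Monotonicity of the gap and of the radius\<close>

text \<open>The contact point moves along its tangent with speed \<open>p x + p2 x\<close>, so the
  gap changes at rate \<open>-(p x + p2 x) * sin (b - x)\<close>, which is negative by positive
  curvature.\<close>

lemma gap_strict_antimono:
  assumes "b - pi \<le> a" "a < a'" "a' \<le> b"
  shows "gap a' b < gap a b"
proof -
  have "\<exists>y. ((\<lambda>t. gap t b) has_real_derivative y) (at x) \<and> y < 0"
    if "a < x" "x < a'" for x
  proof -
    have "((\<lambda>t. gap t b) has_real_derivative - ((p x + p2 x) * sin (b - x))) (at x)"
      unfolding gap_def
      by (rule derivative_eq_intros D1 D2 refl | simp add: algebra_simps)+
    moreover have "sin (b - x) > 0" using that assms by (intro sin_gt_zero) auto
    ultimately show ?thesis using curvature_pos[of x] by (meson mult_pos_pos neg_less_0_iff_less)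
  qed
  moreover have "continuous_on {a..a'} (\<lambda>t. gap t b)"
    unfolding gap_def
    by (intro continuous_intros DERIV_continuous_on[OF D1[THEN DERIV_subset[OF _ subset_UNIV]]]
        DERIV_continuous_on[OF D2[THEN DERIV_subset[OF _ subset_UNIV]]])
  ultimately show ?thesis using DERIV_neg_imp_decreasing_open[OF assms(2)] by blast
qed

lemma gap_pos:
  assumes "b - pi \<le> a" "a < b"
  shows "0 < gap a b"
  using gap_strict_antimono[OF assms(1,2)] by (simp add: gap_def)

lemma gap_pos_left:
  assumes "b < a" "a \<le> b + pi"
  shows "0 < gap a b"
  using support_function.gap_pos[OF reflect, of "- b" "- a"] assms by (simp add: gap_reflect)

text \<open>The sum is the width of the oval in direction \<open>a\<close>, and equals the gap at
  angular distance pi.\<close>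

lemma antipodal_sum_pos: "0 < p a + p (a + pi)"
  using gap_pos[of "a + pi" a] by (simp add: gap_def)

text \<open>The quotient is the distance along \<open>L(a)\<close> from \<gamma>(a) to the
  intersection with \<open>L(b)\<close>.\<close>

lemma gap_over_sin_strict_mono:
  assumes "a < b" "b < c" "c < a + pi"
  shows "gap a b / sin (b - a) < gap a c / sin (c - a)"
proof -
  define g' where "g' x = p1 x + p a * sin (x - a) - p1 a * cos (x - a)" for x
  \<comment> \<open>\<open>Q\<close> is the numerator in the quotient rule for
    \<open>gap a x / sin (x - a)\<close>. Since the gap satisfies g'' + g = p + p'', the derivative
    of \<open>Q\<close> is curvature radius times sine, and \<open>Q\<close> vanishes at
    \<open>a\<close>.\<close>
  define Q where "Q x = g' x * sin (x - a) - gap a x * cos (x - a)" for x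
  have dgap: "(gap a has_real_derivative g' x) (at x)" for x
    unfolding gap_def[abs_def] g'_def
    by (rule derivative_eq_intros D1 refl | simp)+
  have dg': "(g' has_real_derivative p x + p2 x - gap a x) (at x)" for x
    unfolding gap_def g'_def[abs_def]
    by (rule derivative_eq_intros D2 refl | simp)+
  have dQ: "(Q has_real_derivative (p x + p2 x) * sin (x - a)) (at x)" for x
    unfolding Q_def[abs_def]
    by (rule derivative_eq_intros dgap dg' refl | simp add: algebra_simps)+
  have Q_pos: "0 < Q x" if "a < x" "x < a + pi" for x
  proof -
    have "\<exists>y. (Q has_real_derivative y) (at t) \<and> y > 0" if t: "a < t" "t < x" for t
    proof -
      have "sin (t - a) > 0" using t \<open>x < a + pi\<close> by (intro sin_gt_zero) auto
      then show ?thesis using dQ[of t] curvature_pos[of t] by (meson mult_pos_pos)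
    qed
    then have "Q a < Q x"
      by (rule DERIV_pos_imp_increasing_open[OF that(1)])
         (auto intro: continuous_at_imp_continuous_on DERIV_isCont dQ)
    then show ?thesis by (simp add: Q_def gap_def)
  qed
  show ?thesis
  proof (rule DERIV_pos_imp_increasing[OF assms(2), where f = "\<lambda>x. gap a x / sin (x - a)"])
    fix x assume x: "b \<le> x" "x \<le> c"
    then have s: "sin (x - a) > 0" using assms by (intro sin_gt_zero) auto
    have "((\<lambda>x. gap a x / sin (x - a)) has_real_derivative Q x / (sin (x - a))\<^sup>2) (at x)"
      unfolding Q_def using s
      by (auto intro!: derivative_eq_intros dgap simp: power2_eq_square)
    moreover have "Q x / (sin (x - a))\<^sup>2 > 0" using Q_pos[of x] s x assms by simp
    ultimately show "\<exists>y. ((\<lambda>x. gap a x / sin (x - a)) has_real_derivative y) (at x) \<and> 0 < y"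
      by blast
  qed
qed

text \<open>As sin t / (1 + cos t) = tan (t / 2), the radius is the distance along
  \<open>L(a)\<close> times the tangent of the half angle; both factors are positive and
  increasing.\<close>

lemma exradius_strict_mono_right:
  assumes "a < b" "b < c" "c < a + pi"
  shows "exradius a b < exradius a c"
proof -
  have eq: "exradius a x = gap a x / sin (x - a) * tan ((x - a) / 2)"
    if "a < x" "x < a + pi" for x
  proof -
    have "2 * ((x - a) / 2) = x - a" by simp
    then have "tan ((x - a) / 2) = sin (x - a) / (cos (x - a) + 1)"
      using tan_half[of "(x - a) / 2"] by (simp only:)
    then show ?thesis
      using that sin_gt_zero[of "x - a"] by (simp add: exradius_def add.commute)
  qed
  have "0 < gap a b / sin (b - a)"
    using assms gap_pos[of b a] sin_gt_zero[of "b - a"] by simp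
  moreover have "tan ((b - a) / 2) < tan ((c - a) / 2)"
    using assms by (intro tan_monotone) auto
  moreover have "0 < tan ((b - a) / 2)" using assms by (intro tan_gt_zero) auto
  ultimately have "gap a b / sin (b - a) * tan ((b - a) / 2) < gap a c / sin (c - a) * tan ((c - a) / 2)"
    using gap_over_sin_strict_mono[OF assms] by (intro mult_strict_mono) auto
  then show ?thesis using assms by (simp only: eq)
qed

text \<open>As \<open>a\<close> approaches \<open>b\<close>, the numerator falls and the denominator
  grows.\<close>

lemma exradius_strict_antimono_left:
  assumes "b - pi < a" "a < a'" "a' < b"
  shows "exradius a' b < exradius a b"
proof -
  have "cos (b - a) < cos (b - a')" using assms by (intro cos_monotone_0_pi) auto
  moreover have "cos pi < cos (b - a)" using assms by (intro cos_monotone_0_pi) auto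
  ultimately show ?thesis
    unfolding exradius_def using gap_strict_antimono[of b a a'] gap_pos[of b a'] assms
    by (intro frac_less) auto
qed

lemma exradius_strict_antimono_right:
  assumes "a - pi < c" "c < b" "b < a"
  shows "exradius a b < exradius a c"
  using support_function.exradius_strict_mono_right[OF reflect, of "- a" "- b" "- c"] assms
  by (simp add: exradius_reflect)

lemma exradius_strict_mono_left:
  assumes "b < a" "a < a'" "a' < b + pi"
  shows "exradius a b < exradius a' b"
  using support_function.exradius_strict_antimono_left[OF reflect, of "- b" "- a'" "- a"] assms
  by (simp add: exradius_reflect)

section \<open>Tangent lines through a point, as zeros of a support function\<close>

text \<open>This moves the origin to (x, y). The zeros of the new support function are the angles of
  the tangent lines through (x, y), and negative values witness that the point is exterior.\<close>

lemma translate: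
  "support_function (\<lambda>t. p t - x * cos t - y * sin t)
     (\<lambda>t. p1 t + x * sin t - y * cos t) (\<lambda>t. p2 t + x * cos t + y * sin t)"
proof
  fix t
  show "((\<lambda>t. p t - x * cos t - y * sin t) has_real_derivative p1 t + x * sin t - y * cos t) (at t)"
    by (rule derivative_eq_intros D1 refl | simp)+
  show "((\<lambda>t. p1 t + x * sin t - y * cos t) has_real_derivative p2 t + x * cos t + y * sin t) (at t)"
    by (rule derivative_eq_intros D2 refl | simp)+
  show "p (t + 2 * pi) - x * cos (t + 2 * pi) - y * sin (t + 2 * pi) = p t - x * cos t - y * sin t"
    by (simp add: periodic)
  show "0 < p t - x * cos t - y * sin t + (p2 t + x * cos t + y * sin t)"
    using curvature_pos[of t] by simp
qed

text \<open>When \<open>p a = 0\<close>, this ratio differs from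
  \<open>gap a b / sin (b - a)\<close> only by the constant \<open>p1 a\<close>. It follows that at
  most one further zero lies within pi on either side of \<open>a\<close>.\<close>

lemma zero_ratio_strict_mono:
  assumes "p a = 0" "a < b" "b < c" "c < a + pi"
  shows "p b / sin (b - a) < p c / sin (c - a)"
proof -
  have "p x / sin (x - a) = gap a x / sin (x - a) + p1 a" if "a < x" "x < a + pi" for x
    using that sin_gt_zero[of "x - a"] assms(1) by (simp add: gap_def field_simps)
  then show ?thesis using gap_over_sin_strict_mono[of a b c] assms by simp
qed

lemma zero_unique_right:
  assumes "p a = 0" "p b = 0" "p c = 0" "a < b" "b < a + pi" "a < c" "c < a + pi"
  shows "b = c"
  using zero_ratio_strict_mono[of a b c] zero_ratio_strict_mono[of a c b] assms
  by (cases b c rule: linorder_cases) auto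

lemma zero_unique_left:
  assumes "p a = 0" "p b = 0" "p c = 0" "a - pi < b" "b < a" "a - pi < c" "c < a"
  shows "b = c"
  using support_function.zero_unique_right[OF reflect, of "- a" "- b" "- c"] assms by simp

lemma zeros_of_period:
  assumes a: "p a1 = 0" "p a2 = 0" "a1 < a2" "a2 < a1 + pi"
    and b: "p b = 0" "a1 \<le> b" "b < a1 + 2 * pi"
  shows "b = a1 \<or> b = a2"
proof -
  consider "b = a1" | "a1 < b" "b < a1 + pi" | "a1 + pi \<le> b" "b \<le> a2 + pi" | "a2 + pi < b"
    using b by linarith
  then show ?thesis
  proof cases
    case 2
    then show ?thesis using zero_unique_right a b by blast
  next
    case 3
    \<comment> \<open>Between the two zeros \<open>p\<close> is negative, so the antipode of
      \<open>b\<close> has a nonpositive value; positive width then rules out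
      \<open>p b = 0\<close>.\<close>
    have "p (b - pi) \<le> 0"
    proof (cases "b - pi = a1 \<or> b - pi = a2")
      case False
      with 3 have *: "a1 < b - pi" "b - pi < a2" by auto
      then have "p (b - pi) / sin (b - pi - a1) < 0"
        using zero_ratio_strict_mono[of a1 "b - pi" a2] a by simp
      moreover have "sin (b - pi - a1) > 0" using * a by (intro sin_gt_zero) auto
      ultimately show ?thesis by (simp add: divide_less_0_iff)
    qed (use a in auto)
    then show ?thesis using antipodal_sum_pos[of "b - pi"] b by simp
  next
    case 4
    have "p (b - 2 * pi) = 0" using periodic[of "b - 2 * pi"] b by simp
    then show ?thesis using zero_unique_left[of a2 "b - 2 * pi" a1] a b 4 by simp
  qed simp
qed

lemma zero_pairs_congruent:
  assumes a: "p a1 = 0" "p a2 = 0" "a1 < a2" "a2 < a1 + pi"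
    and b: "p b1 = 0" "p b2 = 0" "b1 < b2" "b2 < b1 + pi"
  obtains k :: int where "b1 = a1 + 2 * pi * of_int k" "b2 = a2 + 2 * pi * of_int k"
proof -
  define k where "k = \<lfloor>(b1 - a1) / (2 * pi)\<rfloor>"
  define c1 where "c1 = b1 - 2 * pi * of_int k"
  define c2 where "c2 = b2 - 2 * pi * of_int k"
  have "of_int k \<le> (b1 - a1) / (2 * pi)" "(b1 - a1) / (2 * pi) < of_int k + 1"
    unfolding k_def by linarith+
  then have c: "a1 \<le> c1" "c1 < a1 + 2 * pi"
    by (simp_all add: c1_def field_simps)
  have z: "p c1 = 0" "p c2 = 0"
    using periodic_int[of c1 k] periodic_int[of c2 k] b by (simp_all add: c1_def c2_def)
  have c12: "c1 < c2" "c2 < c1 + pi" using b by (simp_all add: c1_def c2_def)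
  have "c1 = a1 \<or> c1 = a2" using zeros_of_period[OF a z(1) c] .
  \<comment> \<open>If \<open>c1\<close> were \<open>a2\<close>, then \<open>c2\<close> would be a
    zero in the same period beyond both \<open>a1\<close> and \<open>a2\<close>.\<close>
  then have "c1 = a1 \<and> c2 = a2"
    using zeros_of_period[OF a z(2)] c c12 a by auto
  then show thesis by (intro that[of k]) (auto simp: c1_def c2_def)
qed

lemma zero_pair_exists:
  assumes "p a < 0"
  obtains a1 a2 where "a1 < a2" "a2 < a1 + pi" "p a1 = 0" "p a2 = 0"
proof -
  have cont: "continuous_on S p" for S
    by (auto intro: continuous_at_imp_continuous_on DERIV_isCont D1)
  have "p (a - pi) > 0" using antipodal_sum_pos[of "a - pi"] assms by simp
  then obtain a1 where a1: "a - pi \<le> a1" "a1 \<le> a" "p a1 = 0"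
    using IVT2'[of p a 0 "a - pi"] assms cont by auto
  then have less: "a1 < a" using assms by (cases "a1 = a") auto
  \<comment> \<open>The second search ends at \<open>a1 + pi\<close> rather than
    \<open>a + pi\<close>, which keeps the two zeros less than pi apart.\<close>
  have q: "p (a1 + pi) > 0" using antipodal_sum_pos[of a1] a1 by simp
  then obtain a2 where a2: "a \<le> a2" "a2 \<le> a1 + pi" "p a2 = 0"
    using IVT'[of p a 0 "a1 + pi"] assms cont a1 by auto
  then have "a2 \<noteq> a1 + pi" using q by auto
  then show thesis using that[of a1 a2] a1 a2 less by auto
qed

section \<open>Uniqueness of balanced triangles and quadrilaterals with a given side\<close>

text \<open>For fixed \<open>a2\<close>, the balance at side 2 makes \<open>a3\<close> a decreasing function of \<open>a1\<close>, whereas the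
  balance at side 3 makes it an increasing one.\<close>

lemma balanced_triangle_unique:
  assumes a: "a1 < a2" "a2 < a3" "a3 < a2 + pi" "a3 < a1 + 2 * pi" "a1 + 2 * pi < a3 + pi"
    and b: "b1 < a2" "a2 < b3" "b3 < a2 + pi" "b3 < b1 + 2 * pi" "b1 + 2 * pi < b3 + pi"
    and pi: "a2 < a1 + pi"
    and ea: "exradius a2 a1 = exradius a2 a3" "exradius a3 a2 = exradius a3 (a1 + 2 * pi)"
    and eb: "exradius a2 b1 = exradius a2 b3" "exradius b3 a2 = exradius b3 (b1 + 2 * pi)"
    and less: "a1 < b1"
  shows False
proof -
  have "exradius a2 b1 < exradius a2 a1"
    using exradius_strict_antimono_right a b pi less by simp
  then have "\<not> a3 \<le> b3"
    using exradius_strict_mono_right[of a2 a3 b3] a b ea eb by (cases "a3 = b3") auto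
  then have "b3 < a3" by simp
  then have "exradius b3 a2 < exradius a3 a2"
    and "exradius a3 (a1 + 2 * pi) < exradius b3 (a1 + 2 * pi)"
    using exradius_strict_mono_left exradius_strict_antimono_left a b less by auto
  moreover have "exradius b3 (a1 + 2 * pi) < exradius b3 (b1 + 2 * pi)"
    using exradius_strict_mono_right \<open>b3 < a3\<close> a b less by simp
  ultimately show False using ea eb by simp
qed

text \<open>If \<open>a2\<close> is kept and \<open>a1\<close> increases, the balances at sides 2 and 3 force \<open>a4\<close> to decrease,
  and the balance at side 1 forces it to increase.\<close>

lemma balanced_quadrilateral_unique:
  assumes a: "a1 < a2" "a2 < a1 + pi" "a2 < a3" "a3 < a2 + pi" "a3 < a4" "a4 < a3 + pi"
      "a4 < a1 + 2 * pi" "a1 + 2 * pi < a4 + pi"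
    and b: "b1 < a2" "a2 < b1 + pi" "a2 < b3" "b3 < a2 + pi" "b3 < b4" "b4 < b3 + pi"
      "b4 < b1 + 2 * pi" "b1 + 2 * pi < b4 + pi"
    and ea: "exradius a2 a1 = exradius a2 a3" "exradius a3 a2 = exradius a3 a4"
      "exradius (a1 + 2 * pi) a4 = exradius (a1 + 2 * pi) (a2 + 2 * pi)"
    and eb: "exradius a2 b1 = exradius a2 b3" "exradius b3 a2 = exradius b3 b4"
      "exradius (b1 + 2 * pi) b4 = exradius (b1 + 2 * pi) (a2 + 2 * pi)"
    and less: "a1 < b1"
  shows False
proof -
  have "exradius a2 b1 < exradius a2 a1"
    using exradius_strict_antimono_right a b less by simp
  then have "\<not> a3 \<le> b3"
    using exradius_strict_mono_right[of a2 a3 b3] a b ea eb by (cases "a3 = b3") auto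
  then have b3: "b3 < a3" by simp
  then have *: "exradius b3 b4 < exradius a3 a4"
    using exradius_strict_mono_left[of a2 b3 a3] a b ea eb by simp
  have b4: "b4 < a4"
  proof (rule ccontr)
    assume "\<not> b4 < a4"
    then have le: "a4 \<le> b4" by simp
    have "exradius a3 a4 < exradius b3 a4"
      using exradius_strict_antimono_left[of a4 b3 a3] b3 le a b by simp
    moreover have "exradius b3 a4 \<le> exradius b3 b4"
      using exradius_strict_mono_right[of b3 a4 b4] b3 le a b by (cases "a4 = b4") auto
    ultimately show False using * by simp
  qed
  \<comment> \<open>Passing from \<open>a1\<close> to \<open>b1\<close> lowers the radius at side 1
    towards side 2 but raises it towards side 4, so the two balances at side 1 cannot both
    hold.\<close>
  have "exradius (b1 + 2 * pi) (a2 + 2 * pi) < exradius (a1 + 2 * pi) (a2 + 2 * pi)"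
    using exradius_strict_antimono_left[of "a2 + 2 * pi" "a1 + 2 * pi" "b1 + 2 * pi"] a b less by simp
  moreover have "exradius (a1 + 2 * pi) a4 < exradius (b1 + 2 * pi) a4"
    using exradius_strict_mono_left[of a4 "a1 + 2 * pi" "b1 + 2 * pi"] b4 a b less by simp
  moreover have "exradius (b1 + 2 * pi) a4 < exradius (b1 + 2 * pi) b4"
    using exradius_strict_antimono_right[of "b1 + 2 * pi" b4 a4] b4 a b less by simp
  ultimately show False using ea eb by simp
qed


section \<open>The circle K and its tangent lines\<close>

lemma gpt_dot: "fst (gpt p a) * cos b + snd (gpt p a) * sin b = p b - gap a b"
  by (simp add: gpt_def gap_def DERIV_imp_deriv[OF D1] cos_diff sin_diff algebra_simps)

lemma exradius_pos_left:
  assumes "b < a" "a < b + pi"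
  shows "0 < exradius a b"
proof -
  have "cos pi < cos (a - b)" using assms by (intro cos_monotone_0_pi) auto
  then have "1 + cos (b - a) > 0" by (simp add: cos_diff mult.commute)
  then show ?thesis unfolding exradius_def using gap_pos_left assms by simp
qed

lemma circK_eq:
  assumes "a1 < a2" "a2 < a1 + pi"
  defines "r \<equiv> exradius a2 a1"
  shows "circK p a1 a2 = ((fst (gpt p a2) + r * cos a2, snd (gpt p a2) + r * sin a2), r)"
proof -
  have "cos pi < cos (a2 - a1)" using assms(1,2) by (intro cos_monotone_0_pi) auto
  then have c: "1 + cos (a1 - a2) > 0" by (simp add: cos_diff mult.commute)
  have g: "gap a2 a1 > 0" using gap_pos_left assms(1,2) by simp
  have dot: "(fst (gpt p a2) + s * cos a2) * cos a1 + (snd (gpt p a2) + s * sin a2) * sin a1 - p a1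
      = s * cos (a1 - a2) - gap a2 a1" for s
    using gpt_dot[of a2 a1] by (simp add: cos_diff algebra_simps)
  have iff: "s > 0 \<and> \<bar>s * cos (a1 - a2) - gap a2 a1\<bar> = s \<longleftrightarrow> s = r" for s
  proof
    assume s: "s > 0 \<and> \<bar>s * cos (a1 - a2) - gap a2 a1\<bar> = s"
    \<comment> \<open>This excludes the positive sign in the absolute value: the centre cannot lie
      beyond \<open>L(a1)\<close>, because the gap is positive.\<close>
    have "s * cos (a1 - a2) \<le> s" using s by simp
    then have "s * (1 + cos (a1 - a2)) = gap a2 a1" using s g unfolding distrib_left by linarith
    then show "s = r" using c by (simp add: r_def exradius_def field_simps)
  next
    assume s: "s = r"
    then have "s > 0" using exradius_pos_left assms by simp
    moreover have "s * (1 + cos (a1 - a2)) = gap a2 a1" using c s by (simp add: r_def exradius_def)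
    ultimately show "s > 0 \<and> \<bar>s * cos (a1 - a2) - gap a2 a1\<bar> = s" by (simp add: algebra_simps)
  qed
  define C where "C s = (fst (gpt p a2) + s * cos a2, snd (gpt p a2) + s * sin a2)" for s
  have "s > 0 \<and> c = C s \<and> \<bar>fst c * cos a1 + snd c * sin a1 - p a1\<bar> = s \<longleftrightarrow> (c, s) = (C r, r)"
    for c s
    unfolding prod.inject iff[of s, symmetric] using dot[of s] iff[of s] by (auto simp: C_def)
  then have C_iff: "(case q of (c, s) \<Rightarrow> s > 0 \<and> c = C s \<and> \<bar>fst c * cos a1 + snd c * sin a1 - p a1\<bar> = s)
      \<longleftrightarrow> q = (C r, r)" for q
    by (cases q) (simp only: prod.case)
  show ?thesis
    unfolding circK_def C_def[symmetric] by (rule the_equality) (simp_all only: C_iff)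
qed

text \<open>The line \<open>L(b)\<close> misses the contact point of \<open>L(a)\<close>. The range
  is a full turn because the angle from the first to the third side may exceed pi.\<close>

lemma tline_ne:
  assumes "a < b" "b < a + 2 * pi"
  shows "tline p b \<noteq> tline p a"
proof -
  have "0 < gap a b"
  proof (cases "b \<le> a + pi")
    case True
    then show ?thesis using gap_pos assms by simp
  next
    case False
    then have "0 < gap a (b - 2 * pi)" using gap_pos_left assms by simp
    moreover have "b - 2 * pi - a = b - a - 2 * pi" by simp
    ultimately show ?thesis using periodic[of "b - 2 * pi"]
      by (simp add: gap_def cos_diff[of "b - a" "2 * pi"] sin_diff[of "b - a" "2 * pi"])
  qed
  moreover have "gap a a = 0" by (simp add: gap_def)
  ultimately have "gpt p a \<in> tline p a" "gpt p a \<notin> tline p b"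
    using gpt_dot[of a a] gpt_dot[of a b] by (auto simp: tline_def split: prod.splits)
  then show ?thesis by blast
qed

lemma exradius_eq_exists:
  assumes "0 < r"
  obtains b where "a < b" "b < a + pi" "exradius a b = r"
proof -
  \<comment> \<open>Clearing the denominator keeps the function continuous up to
    \<open>a + pi\<close>, where \<open>1 + cos (b - a)\<close> vanishes.\<close>
  define E where "E b = gap a b - r * (1 + cos (b - a))" for b
  have "E a < 0" using assms by (simp add: E_def gap_def)
  moreover have E: "E (a + pi) > 0" using gap_pos[of "a + pi" a] by (simp add: E_def)
  moreover have "continuous_on {a..a + pi} E"
    unfolding E_def gap_def
    by (intro continuous_intros continuous_at_imp_continuous_on ballI DERIV_isCont[OF D1])
  ultimately obtain b where b: "a \<le> b" "b \<le> a + pi" "E b = 0"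
    using IVT'[of E a 0 "a + pi"] by auto
  then have b': "a < b" "b < a + pi" using \<open>E a < 0\<close> E by (auto simp: less_le)
  have "cos pi < cos (b - a)" using b' by (intro cos_monotone_0_pi) auto
  then show thesis using b b' that[of b] by (simp add: E_def exradius_def field_simps)
qed

end

text \<open>Tangency alone leaves the sign of the centre's distance open; the side condition fixes
  it. This turns the conditions on the circle in \<open>next_angle\<close> into one
  equation.\<close>

lemma circle_below_line_iff:
  assumes "0 < r"
  shows "\<bar>fst c * cos a + snd c * sin a - q\<bar> = r \<and>
      (\<forall>z\<in>circle2 c r. fst z * cos a + snd z * sin a \<le> q) \<longleftrightarrow>
    fst c * cos a + snd c * sin a = q - r" (is "?L \<longleftrightarrow> ?R")
proof
  assume L: ?L
  \<comment> \<open>The point of the circle farthest in the normal direction.\<close>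
  define z where "z = c + r *\<^sub>R (cos a, sin a)"
  have "z \<in> circle2 c r"
    using assms
    by (simp add: z_def circle2_def dist_norm norm_Pair power_mult_distrib real_sqrt_mult
        flip: distrib_left)
  with L have "fst z * cos a + snd z * sin a \<le> q" by blast
  moreover have "fst z * cos a + snd z * sin a
      = fst c * cos a + snd c * sin a + r * ((cos a)\<^sup>2 + (sin a)\<^sup>2)"
    unfolding z_def fst_add snd_add fst_scaleR snd_scaleR fst_conv snd_conv real_scaleR_def
    by algebra
  ultimately show ?R using L assms by simp
next
  assume R: ?R
  have "fst z * cos a + snd z * sin a \<le> q" if "z \<in> circle2 c r" for z
  proof -
    have "inner (z - c) (cos a, sin a) \<le> norm (z - c) * norm (cos a, sin a)"
      by (rule norm_cauchy_schwarz)
    also have "\<dots> = r" using that by (simp add: circle2_def dist_norm norm_Pair)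
    finally show ?thesis using R by (simp add: inner_prod_def algebra_simps)
  qed
  then show ?L using R assms by simp
qed

section \<open>Intersections of tangent lines and one step of the map\<close>

text \<open>Cramer's rule, with determinant \<open>sin (b - a)\<close>; the explicit form makes
  continuity in the angles evident.\<close>

definition meet :: "(real \<Rightarrow> real) \<Rightarrow> real \<Rightarrow> real \<Rightarrow> real \<times> real" where
  "meet p a b = ((p a * sin b - p b * sin a) / sin (b - a), (p b * cos a - p a * cos b) / sin (b - a))"

lemma meet_iff:
  assumes "sin (b - a) \<noteq> 0"
  shows "M \<in> tline p a \<and> M \<in> tline p b \<longleftrightarrow> M = meet p a b"
proof (cases M)
  case (Pair x y)
  have s: "sin (b - a) = sin b * cos a - cos b * sin a" by (rule sin_diff)
  have "x * cos a + y * sin a = p a \<and> x * cos b + y * sin b = p b \<longleftrightarrow>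
     x * sin (b - a) = p a * sin b - p b * sin a \<and> y * sin (b - a) = p b * cos a - p a * cos b"
    (is "?l \<longleftrightarrow> ?r")
  proof
    assume ?l
    then have l: "x * cos a + y * sin a = p a" "x * cos b + y * sin b = p b" by auto
    show ?r unfolding s l[symmetric] by (simp add: algebra_simps)
  next
    assume r: ?r
    have "(x * cos a + y * sin a) * sin (b - a) = p a * sin (b - a)"
      using r unfolding s by algebra
    moreover have "(x * cos b + y * sin b) * sin (b - a) = p b * sin (b - a)"
      using r unfolding s by algebra
    ultimately show ?l using assms by simp
  qed
  then show ?thesis using assms Pair by (auto simp: tline_def meet_def field_simps)
qed

context support_function
begin

text \<open>Tangency to K reduces to \<open>gap a2 b = r * (1 + cos (b - a2))\<close>. Existence
  then comes from the intermediate value theorem and uniqueness from strict monotonicity of the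
  radius.\<close>

lemma next_angle_props:
  assumes "a1 < a2" "a2 < a1 + pi"
  shows "a2 < next_angle p a1 a2 \<and> next_angle p a1 a2 < a2 + pi
    \<and> exradius a2 (next_angle p a1 a2) = exradius a2 a1"
proof -
  define r where "r = exradius a2 a1"
  define c where "c = (fst (gpt p a2) + r * cos a2, snd (gpt p a2) + r * sin a2)"
  have r: "r > 0" using exradius_pos_left assms by (simp add: r_def)
  define P where "P a3 \<longleftrightarrow> a2 < a3 \<and> a3 < a2 + pi \<and>
       tline p a3 \<noteq> tline p a1 \<and> tline p a3 \<noteq> tline p a2 \<and>
       \<bar>fst c * cos a3 + snd c * sin a3 - p a3\<bar> = r \<and>
       (\<forall>z\<in>circle2 c r. fst z * cos a3 + snd z * sin a3 \<le> p a3)" for a3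
  have next_eq: "next_angle p a1 a2 = (THE a3. P a3)"
    using circK_eq[OF assms] by (simp add: next_angle_def P_def c_def r_def)
  have dot: "fst c * cos b + snd c * sin b = p b - gap a2 b + r * cos (b - a2)" for b
    using gpt_dot[of a2 b] by (simp add: c_def cos_diff algebra_simps)
  have P_iff: "P b \<longleftrightarrow> a2 < b \<and> b < a2 + pi \<and> exradius a2 b = r" for b
  proof (cases "a2 < b \<and> b < a2 + pi")
    case True
    then have "tline p b \<noteq> tline p a1" "tline p b \<noteq> tline p a2"
      using tline_ne[of a1 b] tline_ne[of a2 b] assms by auto
    then have "P b \<longleftrightarrow> fst c * cos b + snd c * sin b = p b - r"
      using True circle_below_line_iff[OF r, of c b "p b"] by (simp add: P_def)
    also have "\<dots> \<longleftrightarrow> gap a2 b = r * (1 + cos (b - a2))" by (auto simp: dot algebra_simps)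
    also have "\<dots> \<longleftrightarrow> exradius a2 b = r"
    proof -
      have "cos pi < cos (b - a2)" using True by (intro cos_monotone_0_pi) auto
      then show ?thesis by (simp add: exradius_def field_simps)
    qed
    finally show ?thesis using True by simp
  qed (auto simp: P_def)
  have "\<exists>!b. P b"
  proof -
    obtain b where "P b" using exradius_eq_exists[OF r] P_iff by metis
    moreover have "b = b'" if "P b" "P b'" for b b'
      using that exradius_strict_mono_right[of a2 b b'] exradius_strict_mono_right[of a2 b' b]
      by (cases b b' rule: linorder_cases) (auto simp: P_iff)
    ultimately show ?thesis by blast
  qed
  then have "P (next_angle p a1 a2)" unfolding next_eq by (rule theI')
  then show ?thesis by (simp add: P_iff r_def)
qed

lemma tline_shift: "tline p (a + 2 * pi * of_int k) = tline p a"
proof -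
  have "cos (a + 2 * pi * of_int k) = cos a" "sin (a + 2 * pi * of_int k) = sin a"
    by (simp_all add: cos_add sin_add)
  then show ?thesis by (simp add: tline_def periodic_int)
qed

lemma tangent_angles_congruent:
  assumes "M \<in> tline p a1" "M \<in> tline p a2" "a1 < a2" "a2 < a1 + pi"
    and "M \<in> tline p b1" "M \<in> tline p b2" "b1 < b2" "b2 < b1 + pi"
  obtains k :: int where "b1 = a1 + 2 * pi * of_int k" "b2 = a2 + 2 * pi * of_int k"
proof (cases M)
  case (Pair x y)
  show thesis
    by (rule support_function.zero_pairs_congruent[OF translate, of a1 x y a2 b1 b2])
       (use assms Pair that in \<open>auto simp: tline_def\<close>)
qed

lemma tangent_angles_exist:
  assumes "M \<in> oval_exterior p"
  obtains a1 a2 where "a1 < a2" "a2 < a1 + pi" "M \<in> tline p a1" "M \<in> tline p a2"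
proof (cases M)
  case (Pair x y)
  then have "\<exists>a. p a < x * cos a + y * sin a" using assms by (simp add: oval_exterior_def)
  then obtain a where "p a < x * cos a + y * sin a" by blast
  then have "p a - x * cos a - y * sin a < 0" by linarith
  then show thesis
    by (rule support_function.zero_pair_exists[OF translate])
       (use Pair that in \<open>auto simp: tline_def\<close>)
qed

text \<open>The angles selected by \<open>SOME\<close> agree with \<open>a1\<close>,
  \<open>a2\<close> up to a common number of full turns. Undoing that shift lets an orbit be
  followed by one increasing sequence of real angles.\<close>

lemma outer_T_step:
  assumes "a1 < a2" "a2 < a1 + pi" "M \<in> tline p a1" "M \<in> tline p a2"
  obtains a3 where "a2 < a3" "a3 < a2 + pi" "exradius a2 a1 = exradius a2 a3"
    "outer_T p M \<in> tline p a2" "outer_T p M \<in> tline p a3"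
proof -
  define S where "S = (\<lambda>(a1, a2). a1 < a2 \<and> a2 < a1 + pi \<and> M \<in> tline p a1 \<and> M \<in> tline p a2)"
  obtain b1 b2 where b: "(SOME q. S q) = (b1, b2)" by fastforce
  have "S (SOME q. S q)" by (rule someI[of S "(a1, a2)"]) (use assms in \<open>simp add: S_def\<close>)
  then have bS: "b1 < b2" "b2 < b1 + pi" "M \<in> tline p b1" "M \<in> tline p b2"
    unfolding b by (auto simp: S_def)
  then obtain k :: int where k: "b1 = a1 + 2 * pi * of_int k" "b2 = a2 + 2 * pi * of_int k"
    using tangent_angles_congruent assms by metis
  define b3 where "b3 = next_angle p b1 b2"
  have b3: "b2 < b3" "b3 < b2 + pi" "exradius b2 b3 = exradius b2 b1"
    using next_angle_props[OF bS(1,2)] by (auto simp: b3_def)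
  have "sin (b3 - b2) > 0" using b3 by (intro sin_gt_zero) auto
  then have "(THE N. N \<in> tline p b2 \<inter> tline p b3) = meet p b2 b3"
    using meet_iff[of b3 b2] by (intro the_equality) auto
  moreover have "outer_T p M = (THE N. N \<in> tline p b2 \<inter> tline p b3)"
    using b by (simp add: outer_T_def S_def b3_def)
  ultimately have T: "outer_T p M \<in> tline p b2" "outer_T p M \<in> tline p b3"
    using meet_iff[of b3 b2 "outer_T p M" p] \<open>sin (b3 - b2) > 0\<close> by auto
  define a3 where "a3 = b3 - 2 * pi * of_int k"
  have b3_eq: "b3 = a3 + 2 * pi * of_int k" by (simp add: a3_def)
  show thesis
    by (rule that[of a3]) (use b3 T in \<open>auto simp: k b3_eq exradius_shift tline_shift\<close>)
qed

section \<open>Periodic orbits close up after one turn\<close>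

lemma period_eq_one:
  assumes "b1 = a1 + 2 * pi * of_int k" "a1 < b1" "b1 < a1 + 4 * pi"
  shows "(k::int) = 1"
proof -
  have "0 < 2 * pi * of_int k" "2 * pi * of_int k < 2 * pi * 2" using assms by auto
  then have "0 < k" "of_int k < (2::real)"
    by (simp_all add: zero_less_mult_iff)
  then show ?thesis by simp
qed

lemma outer_T_period3:
  assumes a: "a1 < a2" "a2 < a1 + pi" "M \<in> tline p a1" "M \<in> tline p a2"
    and fixed: "(outer_T p ^^ 3) M = M"
  obtains a3 where "a2 < a3" "a3 < a2 + pi" "a3 < a1 + 2 * pi" "a1 + 2 * pi < a3 + pi"
    "exradius a2 a1 = exradius a2 a3" "exradius a3 a2 = exradius a3 (a1 + 2 * pi)"
proof -
  obtain a3 where a3: "a2 < a3" "a3 < a2 + pi" "exradius a2 a1 = exradius a2 a3"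
    "outer_T p M \<in> tline p a2" "outer_T p M \<in> tline p a3"
    using outer_T_step a by metis
  obtain a4 where a4: "a3 < a4" "a4 < a3 + pi" "exradius a3 a2 = exradius a3 a4"
    "outer_T p (outer_T p M) \<in> tline p a3" "outer_T p (outer_T p M) \<in> tline p a4"
    using outer_T_step a3(1,2,4,5) by metis
  obtain a5 where a5: "a4 < a5" "a5 < a4 + pi" "exradius a4 a3 = exradius a4 a5"
    "outer_T p (outer_T p (outer_T p M)) \<in> tline p a4"
    "outer_T p (outer_T p (outer_T p M)) \<in> tline p a5"
    using outer_T_step a4(1,2,4,5) by metis
  have "outer_T p (outer_T p (outer_T p M)) = M" using fixed by (simp add: numeral_3_eq_3)
  \<comment> \<open>The third image lies on \<open>L(a4)\<close> and \<open>L(a5)\<close>. As it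
    equals \<open>M\<close>, these angles are \<open>a1\<close>, \<open>a2\<close> up to full
    turns.\<close>
  then obtain k :: int where k: "a4 = a1 + 2 * pi * of_int k"
    using tangent_angles_congruent[of M a1 a2 a4 a5] a a5 by metis
  then have "k = 1" using a a3(1,2) a4(1,2) by (intro period_eq_one[OF k]) linarith+
  then show thesis using that[of a3] a3 a4 k by simp
qed

lemma outer_T_period4:
  assumes a: "a1 < a2" "a2 < a1 + pi" "M \<in> tline p a1" "M \<in> tline p a2"
    and fixed: "(outer_T p ^^ 4) M = M"
  obtains a3 a4 where "a2 < a3" "a3 < a2 + pi" "a3 < a4" "a4 < a3 + pi"
    "a4 < a1 + 2 * pi" "a1 + 2 * pi < a4 + pi"
    "exradius a2 a1 = exradius a2 a3" "exradius a3 a2 = exradius a3 a4"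
    "exradius (a1 + 2 * pi) a4 = exradius (a1 + 2 * pi) (a2 + 2 * pi)"
proof -
  obtain a3 where a3: "a2 < a3" "a3 < a2 + pi" "exradius a2 a1 = exradius a2 a3"
    "outer_T p M \<in> tline p a2" "outer_T p M \<in> tline p a3"
    using outer_T_step a by metis
  obtain a4 where a4: "a3 < a4" "a4 < a3 + pi" "exradius a3 a2 = exradius a3 a4"
    "outer_T p (outer_T p M) \<in> tline p a3" "outer_T p (outer_T p M) \<in> tline p a4"
    using outer_T_step a3(1,2,4,5) by metis
  obtain a5 where a5: "a4 < a5" "a5 < a4 + pi" "exradius a4 a3 = exradius a4 a5"
    "outer_T p (outer_T p (outer_T p M)) \<in> tline p a4"
    "outer_T p (outer_T p (outer_T p M)) \<in> tline p a5"
    using outer_T_step a4(1,2,4,5) by metis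
  obtain a6 where a6: "a5 < a6" "a6 < a5 + pi" "exradius a5 a4 = exradius a5 a6"
    "outer_T p (outer_T p (outer_T p (outer_T p M))) \<in> tline p a5"
    "outer_T p (outer_T p (outer_T p (outer_T p M))) \<in> tline p a6"
    using outer_T_step a5(1,2,4,5) by metis
  have "outer_T p (outer_T p (outer_T p (outer_T p M))) = M"
    using fixed by (simp add: eval_nat_numeral)
  then obtain k :: int where k: "a5 = a1 + 2 * pi * of_int k" "a6 = a2 + 2 * pi * of_int k"
    using tangent_angles_congruent[of M a1 a2 a5 a6] a a6 by metis
  \<comment> \<open>Four steps, each shorter than pi, cover less than two full turns.\<close>
  then have "k = 1" using a a3(1,2) a4(1,2) a5(1,2) by (intro period_eq_one[OF k(1)]) linarith+
  then show thesis using that[of a3 a4] a3 a4 a5 a6 k by simp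
qed

section \<open>Empty interior\<close>

text \<open>Slide \<open>M\<close> along \<open>L(a2)\<close> by increasing the first angle
  slightly: by continuity of \<open>meet\<close> the point stays in the open set.\<close>

lemma interior_two_points_on_tangent:
  assumes "M \<in> interior (S \<inter> oval_exterior p)"
  obtains a1 b1 a2 N where "a1 < b1" "b1 < a2" "a2 < a1 + pi"
    "M \<in> S" "M \<in> tline p a1" "M \<in> tline p a2" "N \<in> S" "N \<in> tline p b1" "N \<in> tline p a2"
proof -
  have M: "M \<in> S" "M \<in> oval_exterior p" using assms interior_subset by blast+
  obtain a1 a2 where a: "a1 < a2" "a2 < a1 + pi" "M \<in> tline p a1" "M \<in> tline p a2"
    using tangent_angles_exist[OF M(2)] by metis
  have s: "sin (a2 - b) > 0" if "a1 \<le> b" "b < a2" for b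
    using that a by (intro sin_gt_zero) auto
  have "isCont (\<lambda>b. meet p b a2) a1"
    unfolding meet_def using s[of a1] a(1)
    by (intro continuous_intros DERIV_isCont[OF D1]) auto
  moreover have Meq: "meet p a1 a2 = M" using meet_iff[of a2 a1 M p] s[of a1] a by simp
  ultimately have "((\<lambda>b. meet p b a2) \<longlongrightarrow> M) (at a1)" by (simp add: isCont_def)
  then have "((\<lambda>b. meet p b a2) \<longlongrightarrow> M) (at_right a1)"
    by (rule tendsto_mono[rotated]) (simp add: at_le)
  then have "\<forall>\<^sub>F b in at_right a1. meet p b a2 \<in> interior (S \<inter> oval_exterior p)"
    using assms by (rule topological_tendstoD[OF _ open_interior])
  moreover have "\<forall>\<^sub>F b in at_right a1. b \<in> {a1<..<a2}"
    by (rule eventually_at_rightI[OF _ a(1)])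
  ultimately have "\<forall>\<^sub>F b in at_right a1. meet p b a2 \<in> interior (S \<inter> oval_exterior p) \<and> b \<in> {a1<..<a2}"
    by (rule eventually_conj)
  then have "\<exists>b. meet p b a2 \<in> interior (S \<inter> oval_exterior p) \<and> b \<in> {a1<..<a2}"
    by (rule eventually_happens'[OF trivial_limit_at_right_real])
  then obtain b where b: "meet p b a2 \<in> interior (S \<inter> oval_exterior p)" "a1 < b" "b < a2"
    by auto
  then have "meet p b a2 \<in> S" using interior_subset by blast
  moreover have "meet p b a2 \<in> tline p b" "meet p b a2 \<in> tline p a2"
    using meet_iff[of a2 b "meet p b a2" p] s[of b] b by auto
  ultimately show thesis using that a b M by blast
qed

lemma interior_period3: "interior ({M. (outer_T p ^^ 3) M = M} \<inter> oval_exterior p) = {}"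
proof (rule ccontr)
  assume "\<not> ?thesis"
  then obtain M where M': "M \<in> interior ({M. (outer_T p ^^ 3) M = M} \<inter> oval_exterior p)" by blast
  obtain a1 b1 a2 N where ab: "a1 < b1" "b1 < a2" "a2 < a1 + pi"
    and M: "(outer_T p ^^ 3) M = M" "M \<in> tline p a1" "M \<in> tline p a2"
    and N: "(outer_T p ^^ 3) N = N" "N \<in> tline p b1" "N \<in> tline p a2"
    by (rule interior_two_points_on_tangent[OF M']) blast
  obtain a3 where "a2 < a3" "a3 < a2 + pi" "a3 < a1 + 2 * pi" "a1 + 2 * pi < a3 + pi"
    "exradius a2 a1 = exradius a2 a3" "exradius a3 a2 = exradius a3 (a1 + 2 * pi)"
    by (rule outer_T_period3[of a1 a2 M]) (use ab M in auto)
  moreover obtain b3 where "a2 < b3" "b3 < a2 + pi" "b3 < b1 + 2 * pi" "b1 + 2 * pi < b3 + pi"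
    "exradius a2 b1 = exradius a2 b3" "exradius b3 a2 = exradius b3 (b1 + 2 * pi)"
    by (rule outer_T_period3[of b1 a2 N]) (use ab N in auto)
  ultimately show False using balanced_triangle_unique[of a1 a2 a3 b1 b3] ab by simp
qed

lemma interior_period4: "interior ({M. (outer_T p ^^ 4) M = M} \<inter> oval_exterior p) = {}"
proof (rule ccontr)
  assume "\<not> ?thesis"
  then obtain M where M': "M \<in> interior ({M. (outer_T p ^^ 4) M = M} \<inter> oval_exterior p)" by blast
  obtain a1 b1 a2 N where ab: "a1 < b1" "b1 < a2" "a2 < a1 + pi"
    and M: "(outer_T p ^^ 4) M = M" "M \<in> tline p a1" "M \<in> tline p a2"
    and N: "(outer_T p ^^ 4) N = N" "N \<in> tline p b1" "N \<in> tline p a2"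
    by (rule interior_two_points_on_tangent[OF M']) blast
  obtain a3 a4 where "a2 < a3" "a3 < a2 + pi" "a3 < a4" "a4 < a3 + pi"
    "a4 < a1 + 2 * pi" "a1 + 2 * pi < a4 + pi"
    "exradius a2 a1 = exradius a2 a3" "exradius a3 a2 = exradius a3 a4"
    "exradius (a1 + 2 * pi) a4 = exradius (a1 + 2 * pi) (a2 + 2 * pi)"
    by (rule outer_T_period4[of a1 a2 M]) (use ab M in auto)
  moreover obtain b3 b4 where "a2 < b3" "b3 < a2 + pi" "b3 < b4" "b4 < b3 + pi"
    "b4 < b1 + 2 * pi" "b1 + 2 * pi < b4 + pi"
    "exradius a2 b1 = exradius a2 b3" "exradius b3 a2 = exradius b3 b4"
    "exradius (b1 + 2 * pi) b4 = exradius (b1 + 2 * pi) (a2 + 2 * pi)"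
    by (rule outer_T_period4[of b1 a2 N]) (use ab N in auto)
  ultimately show False using balanced_quadrilateral_unique[of a1 a2 a3 a4 b1 b3 b4] ab by simp
qed

end

lemma oval_support_imp_support_function:
  assumes "oval_support p"
  shows "support_function p (deriv p) (deriv (deriv p))"
proof
  fix x
  have d: "(deriv ^^ n) p differentiable (at x)" for n
    using assms by (simp add: oval_support_def)
  show "(p has_real_derivative deriv p x) (at x)"
    using d[of 0] by (simp add: DERIV_deriv_iff_real_differentiable)
  show "(deriv p has_real_derivative deriv (deriv p) x) (at x)"
    using d[of 1] by (simp add: DERIV_deriv_iff_real_differentiable)
qed (use assms in \<open>auto simp: oval_support_def\<close>)

theorem mainTheorem6:
  fixes p :: "real \<Rightarrow> real"
  assumes "oval_support p"
  shows "interior {M \<in> oval_exterior p. (outer_T p ^^ 3) M = M} = {} \<and>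
         interior {M \<in> oval_exterior p. (outer_T p ^^ 4) M = M} = {}"
proof -
  interpret support_function p "deriv p" "deriv (deriv p)"
    using assms by (rule oval_support_imp_support_function)
  have "{M \<in> oval_exterior p. P M} = {M. P M} \<inter> oval_exterior p" for P
    by blast
  then show ?thesis using interior_period3 interior_period4 by simp
qed

end
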